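(* For every $n\ge 1$, the number of $(132,321)$-sortable permutations of length $n$ is equal to the number of Dyck paths of semilength $n$ avoiding the consecutive pattern $\mathtt{DUDU}$.
   Context: A Dyck path of semilength $n$ is a word with $n$ letters $\mathtt{U}$ and $n$ letters $\mathtt{D}$ such that every prefix contains at least as many $\mathtt{U}$'s as $\mathtt{D}$'s. It avoids $\mathtt{DUDU}$ if $\mathtt{DUDU}$ does not occur as a factor (four consecutive letters). For a set $\Sigma$ of permutations of length at least $2$, the $\Sigma$-stack acts on an input permutation $\pi=\pi_1\cdots\pi_n$ as follows (starting with empty stack and output). For $i=1,\dots,n$: as long as pushing $\pi_i$ on top of the stack would make the content of the stack, read from top to bottom, contain an occurrence of some $\sigma\in\Sigma$ (a subsequence order isomorphic to $\sigma$), pop the top element and append it to the output; then push $\pi_i$. After all letters have been pushed, pop all remaining elements, from top to bottom, appending them to the output. The resulting output is denoted $\mathcal{S}^{\Sigma}(\pi)$. The permutation $\pi$ of length $n$ is $\Sigma$-sortable if $\mathcal{S}^{21}(\mathcal{S}^{\Sigma}(\pi))=12\cdots n$, where $\mathcal{S}^{21}=\mathcal{S}^{\{21\}}$. For $\Sigma=\{\sigma,\tau\}$ one writes $(\sigma,\tau)$-sortable. *)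

theory Defs
  imports "HOL-Library.Sublist" "HOL-Combinatorics.Multiset_Permutations"
begin

text \<open>
  Permutations are lists of natural numbers in one-line notation; those of length \<open>n\<close> are the
  elements of \<^term>\<open>permutations_of_set {1..n}\<close>.
\<close>

definition order_isomorphic :: "nat list \<Rightarrow> nat list \<Rightarrow> bool" where
  "order_isomorphic xs ys \<longleftrightarrow>
     length xs = length ys \<and>
     (\<forall>i < length xs. \<forall>j < length xs. xs ! i < xs ! j \<longleftrightarrow> ys ! i < ys ! j)"

definition contains_pattern :: "nat list \<Rightarrow> nat list \<Rightarrow> bool" where
  "contains_pattern w p \<longleftrightarrow> (\<exists>zs. subseq zs w \<and> order_isomorphic zs p)"

text \<open>
  The second argument is the current stack, listed from top to bottom, the third one the remaining
  input; the result is the output still to be produced. The second equation covers the empty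
  stack, where nothing can be popped; as patterns have length at least 2, the push is then
  always legal.
\<close>

fun stack_run :: "nat list set \<Rightarrow> nat list \<Rightarrow> nat list \<Rightarrow> nat list" where
  "stack_run S st [] = st"
| "stack_run S [] (x # xs) = stack_run S [x] xs"
| "stack_run S (y # st) (x # xs) =
     (if \<exists>p\<in>S. contains_pattern (x # y # st) p
      then y # stack_run S st (x # xs)
      else stack_run S (x # y # st) xs)"

definition stack_map :: "nat list set \<Rightarrow> nat list \<Rightarrow> nat list" where
  "stack_map S xs = stack_run S [] xs"

definition stack_sortable :: "nat list set \<Rightarrow> nat list \<Rightarrow> bool" where
  "stack_sortable S xs \<longleftrightarrow> stack_map {[2, 1]} (stack_map S xs) = [1..<Suc (length xs)]"

datatype step = U | D

definition dyck_path :: "nat \<Rightarrow> step list \<Rightarrow> bool" where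
  "dyck_path n w \<longleftrightarrow>
     count_list w U = n \<and> count_list w D = n \<and>
     (\<forall>v. prefix v w \<longrightarrow> count_list v D \<le> count_list v U)"

end

theory Submission
  imports Defs
begin

text \<open>
  Both sides count the same sequences of heights \<open>h\<^sub>1 \<le> h\<^sub>2 \<le> \<dots> \<le> h\<^sub>n\<close> with \<open>h\<^sub>i < i\<close>, with the extra
  condition that no strict rise \<open>h\<^sub>i\<^sub>-\<^sub>1 < h\<^sub>i\<close> is followed at once by a rise \<open>h\<^sub>i\<^sub>+\<^sub>1 = h\<^sub>i + 1\<close> of
  exactly one (where \<open>h\<^sub>0 = 0\<close>). Such sequences are called profiles.

  On Dyck paths, \<open>h\<^sub>i\<close> is the number of down steps before the \<open>i\<close>-th up step. Strict rises are the
  valleys \<open>DU\<close>, the size of the rise being the length of the run of down steps, so in a factor \<open>DUDU\<close>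
  the second \<open>DU\<close> is a rise of exactly one right after a strict rise (\<open>card_dyck\<close>).

  On permutations, call a letter a minimum if it is smaller than all letters before it. The machine
  turns out to sort exactly the permutations in which the letters that are not minima are
  decreasing (that is, 123 is avoided) and in which two such letters standing next to each other
  never have consecutive values. The reason is that, as long as these conditions hold, the stack
  contains all minima seen so far, increasing from top to bottom, with at most one further letter
  above them, while all other letters have left in decreasing order. The final output decreases and
  then increases, so it has no 231, which is what the second stack needs. The first letter that
  violates the conditions creates a 231 in the output, and this cannot be repaired later because
  the stack content and the output are only ever interleaved with new letters
  (\<open>has_231_stack_map_iff\<close>).

  Finally, such a permutation is built by appending a last letter and relabelling the others.
  Appending \<open>1\<close> adds a minimum; any other letter \<open>q\<close> must lie below all earlier nonminima, and if the
  previous letter is the lowest nonminimum then \<open>q\<close> must not be adjacent to it in value. With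
  \<open>h = n + 1 - \<close>(lowest nonminimum), or \<open>h = 0\<close> if there is none, a new minimum
  keeps \<open>h\<close> and a new nonminimum raises it to an arbitrary larger value up to the number of earlier
  letters, except that a rise right after another one cannot have size one. These are the rules of profiles
  (\<open>bij_betw_perm_of_profile\<close>).

  Permutations and profiles are represented by lists with the newest entry first: appending a
  letter becomes a list constructor, and the minima occur in such a list in the order in which the
  stack holds them from top to bottom.
\<close>

section \<open>The classical stack and the pattern 231\<close>

lemma order_isomorphic_132:
  "order_isomorphic zs [1, 3, 2] \<longleftrightarrow> (\<exists>a b c. zs = [a, c, b] \<and> a < b \<and> b < c)"
proof (cases "\<exists>x y z. zs = [x, y, z]")
  case True
  then obtain x y z where "zs = [x, y, z]" by blast
  then show ?thesis
    by (auto simp: order_isomorphic_def All_less_Suc numeral_3_eq_3)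
next
  case False
  then show ?thesis
    by (auto simp: order_isomorphic_def length_Suc_conv)
qed

lemma order_isomorphic_321:
  "order_isomorphic zs [3, 2, 1] \<longleftrightarrow> (\<exists>a b c. zs = [c, b, a] \<and> a < b \<and> b < c)"
proof (cases "\<exists>x y z. zs = [x, y, z]")
  case True
  then obtain x y z where "zs = [x, y, z]" by blast
  then show ?thesis
    by (auto simp: order_isomorphic_def All_less_Suc numeral_3_eq_3)
next
  case False
  then show ?thesis
    by (auto simp: order_isomorphic_def length_Suc_conv)
qed

lemma order_isomorphic_21:
  "order_isomorphic zs [2, 1] \<longleftrightarrow> (\<exists>a b. zs = [b, a] \<and> a < b)"
proof (cases "\<exists>x y. zs = [x, y]")
  case True
  then obtain x y where "zs = [x, y]" by blast
  then show ?thesis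
    by (auto simp: order_isomorphic_def All_less_Suc numeral_2_eq_2)
next
  case False
  then show ?thesis
    by (auto simp: order_isomorphic_def length_Suc_conv)
qed

lemma contains_132_iff:
  "contains_pattern w [1, 3, 2] \<longleftrightarrow> (\<exists>a b c. subseq [a, c, b] w \<and> a < b \<and> b < c)"
  unfolding contains_pattern_def order_isomorphic_132 by blast

lemma contains_321_iff:
  "contains_pattern w [3, 2, 1] \<longleftrightarrow> (\<exists>a b c. subseq [c, b, a] w \<and> a < b \<and> b < c)"
  unfolding contains_pattern_def order_isomorphic_321 by blast

lemma contains_21_iff:
  "contains_pattern w [2, 1] \<longleftrightarrow> (\<exists>a b. subseq [b, a] w \<and> a < b)"
  unfolding contains_pattern_def order_isomorphic_21 by blast

lemma subseq_pair_Cons: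
  "subseq [b, a] (x # w) \<longleftrightarrow> subseq [b, a] w \<or> b = x \<and> a \<in> set w"
  by (cases "b = x") (auto simp: subseq_singleton_left dest: subseq_Cons')

lemma subseq_pair_in_set: "subseq [b, a] w \<Longrightarrow> b \<in> set w \<and> a \<in> set w"
  by (induction w) (auto simp: subseq_pair_Cons simp del: subseq_Cons2_iff)

lemma subseq_pair_sorted_wrt: "sorted_wrt R w \<Longrightarrow> subseq [a, b] w \<Longrightarrow> R a b"
  by (induction w) (auto simp: subseq_pair_Cons simp del: subseq_Cons2_iff)

definition has_231 :: "nat list \<Rightarrow> bool" where
  "has_231 w \<longleftrightarrow> (\<exists>a b c. subseq [b, c, a] w \<and> a < b \<and> b < c)"

lemma has_231_subseq: "has_231 v \<Longrightarrow> subseq v w \<Longrightarrow> has_231 w"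
  unfolding has_231_def using subseq_order.order_trans by blast

lemma has_231_Cons:
  "has_231 (x # w) \<longleftrightarrow> has_231 w \<or> (\<exists>a c. subseq [c, a] w \<and> a < x \<and> x < c)"
proof -
  have "subseq [b, c, a] (x # w) \<longleftrightarrow> subseq [b, c, a] w \<or> b = x \<and> subseq [c, a] w" for a b c
    by (cases "b = x") (auto dest: subseq_Cons')
  then show ?thesis unfolding has_231_def by blast
qed

lemma mset_stack_run: "mset (stack_run S st xs) = mset st + mset xs"
  by (induction S st xs rule: stack_run.induct) auto

lemma set_stack_run: "set (stack_run S st xs) = set st \<union> set xs"
  by (metis mset_append mset_stack_run set_append set_mset_mset)

text \<open>
  The stack is last-in first-out, so what it holds at some moment leaves in the order from top to
  bottom, whatever is pushed in between. A bad pattern on the stack is therefore a bad pattern of the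
  output.
\<close>

lemma subseq_stack_run: "subseq st (stack_run S st xs)"
proof (induction S st xs rule: stack_run.induct)
  case (3 S y st x xs)
  then show ?case
    by (auto dest: subseq_Cons')
qed auto

lemma contains_21_Cons_sorted:
  assumes "sorted_wrt (<) (y # st)"
  shows "contains_pattern (x # y # st) [2, 1] \<longleftrightarrow> y < x"
proof
  assume "contains_pattern (x # y # st) [2, 1]"
  then obtain a b where ab: "subseq [b, a] (x # y # st)" "a < b"
    unfolding contains_21_iff by blast
  show "y < x"
  proof (cases "subseq [b, a] (y # st)")
    case True
    then show ?thesis using subseq_pair_sorted_wrt[OF assms] ab(2) by fastforce
  next
    case False
    then have "b = x" "a \<in> set (y # st)"
      using ab(1) unfolding subseq_pair_Cons[of b a x] by blast+
    then show ?thesis using assms ab(2) by auto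
  qed
next
  assume "y < x"
  then show "contains_pattern (x # y # st) [2, 1]"
    unfolding contains_21_iff subseq_pair_Cons[of _ _ x] by (metis list.set_intros(1))
qed

text \<open>
  Knuth's criterion, generalised from the empty stack so that induction applies: a letter \<open>b\<close> that is
  still on the stack leaves too early exactly if the remaining input has a larger letter, which
  forces \<open>b\<close> out, followed by a smaller one.
\<close>

lemma sorted_stack_run_21_iff:
  assumes "sorted_wrt (<) st" "distinct (st @ xs)"
  shows "sorted_wrt (<) (stack_run {[2, 1]} st xs) \<longleftrightarrow>
         \<not> has_231 xs \<and> \<not> (\<exists>b\<in>set st. \<exists>a c. subseq [c, a] xs \<and> a < b \<and> b < c)"
  using assms
proof (induction "{[2::nat, 1]}" st xs rule: stack_run.induct)
  case (1 st)
  then show ?case by (simp add: has_231_def)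
next
  case (2 x xs)
  then show ?case by (simp add: has_231_Cons)
next
  case (3 y st x xs)
  let ?Q = "\<lambda>b ys. \<exists>a c. subseq [c, a] ys \<and> a < b \<and> b < c"
  have pop_iff: "(\<exists>p\<in>{[2, 1]}. contains_pattern (x # y # st) p) \<longleftrightarrow> y < x"
    using contains_21_Cons_sorted[OF 3(3)] by simp
  have st: "sorted_wrt (<) st" "\<forall>z\<in>set st. y < z" using 3(3) by auto
  show ?case
  proof (cases "y < x")
    case True
    have y_least: "(\<forall>z\<in>set st \<union> set (x # xs). y < z) \<longleftrightarrow> \<not> ?Q y (x # xs)"
    proof
      assume "\<forall>z\<in>set st \<union> set (x # xs). y < z"
      then show "\<not> ?Q y (x # xs)"
        by (meson UnI2 less_asym subseq_pair_in_set)
    next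
      assume no: "\<not> ?Q y (x # xs)"
      have "y < a" if "a \<in> set xs" for a
      proof -
        have "subseq [x, a] (x # xs)" using that by (simp add: subseq_singleton_left)
        then have "\<not> a < y" using no True by blast
        moreover have "a \<noteq> y" using 3(4) that by auto
        ultimately show ?thesis by simp
      qed
      then show "\<forall>z\<in>set st \<union> set (x # xs). y < z" using True st(2) by auto
    qed
    have IH: "sorted_wrt (<) (stack_run {[2, 1]} st (x # xs)) \<longleftrightarrow>
        \<not> has_231 (x # xs) \<and> \<not> (\<exists>b\<in>set st. ?Q b (x # xs))"
      using 3(1) True pop_iff st(1) 3(4) by simp
    have "sorted_wrt (<) (stack_run {[2, 1]} (y # st) (x # xs)) \<longleftrightarrow>
        (\<forall>z\<in>set st \<union> set (x # xs). y < z) \<and> sorted_wrt (<) (stack_run {[2, 1]} st (x # xs))"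
      using True pop_iff by (simp add: set_stack_run)
    then show ?thesis unfolding IH y_least by (simp del: subseq_Cons2_iff) blast
  next
    case False
    then have "x < y" using 3(4) by auto
    then have "sorted_wrt (<) (x # y # st)" using st by auto
    then have IH: "sorted_wrt (<) (stack_run {[2, 1]} (x # y # st) xs) \<longleftrightarrow>
        \<not> has_231 xs \<and> \<not> (\<exists>b\<in>set (x # y # st). ?Q b xs)"
      using 3(2) False pop_iff 3(4) by simp
    have no: "\<not> b < x" if "b \<in> set (y # st)" for b
      using that \<open>x < y\<close> st(2) by auto
    have "?Q b (x # xs) \<longleftrightarrow> ?Q b xs" if "b \<in> set (y # st)" for b
      unfolding subseq_pair_Cons[of _ _ x] using no[OF that] less_asym \<open>x < y\<close> st(2) that
      by (metis less_trans set_ConsD)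
    then have "(\<exists>b\<in>set (y # st). ?Q b (x # xs)) \<longleftrightarrow> (\<exists>b\<in>set (y # st). ?Q b xs)"
      by blast
    moreover have "stack_run {[2, 1]} (y # st) (x # xs) = stack_run {[2, 1]} (x # y # st) xs"
      using False pop_iff by simp
    ultimately show ?thesis using IH unfolding has_231_Cons by (simp only: list.set) blast
  qed
qed

lemma stack_sortable_iff:
  assumes "xs \<in> permutations_of_set {1..n}"
  shows "stack_sortable S xs \<longleftrightarrow> \<not> has_231 (stack_map S xs)"
proof -
  let ?ys = "stack_map S xs"
  let ?zs = "stack_map {[2, 1]} ?ys"
  have mset_map: "mset (stack_map S' zs) = mset zs" for S' zs
    by (simp add: stack_map_def mset_stack_run)
  have xs: "distinct xs" "set xs = {1..n}"
    using assms by (auto simp: permutations_of_set_def)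
  have len: "length xs = n"
    using distinct_card[OF xs(1)] xs(2) by simp
  have ys: "distinct ?ys"
    using xs(1) mset_map mset_eq_imp_distinct_iff by blast
  have "set ?zs = {1..n}"
    using xs(2) mset_map mset_eq_setD by metis
  then have "?zs = [1..<Suc n] \<longleftrightarrow> sorted_wrt (<) ?zs"
    by (metis atLeastLessThanSuc_atLeastAtMost set_upt sorted_wrt_upt
        strict_sorted_equal)
  also have "\<dots> \<longleftrightarrow> \<not> has_231 ?ys"
    using sorted_stack_run_21_iff[of "[]" ?ys] ys
    unfolding stack_map_def[of "{[2, 1]}"] by simp
  finally show ?thesis by (simp add: stack_sortable_def len)
qed

section \<open>The stack of the pair 132, 321\<close>

abbreviation T :: "nat list set" where
  "T \<equiv> {[1, 3, 2], [3, 2, 1]}"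

abbreviation new_min :: "nat \<Rightarrow> nat list \<Rightarrow> bool" where
  "new_min x r \<equiv> \<forall>y\<in>set r. x < y"

fun minima :: "nat list \<Rightarrow> nat list" where
  "minima [] = []"
| "minima (x # r) = (if new_min x r then x # minima r else minima r)"

fun nonminima :: "nat list \<Rightarrow> nat list" where
  "nonminima [] = []"
| "nonminima (x # r) = (if new_min x r then nonminima r else x # nonminima r)"

fun ends_high :: "nat list \<Rightarrow> bool" where
  "ends_high [] \<longleftrightarrow> False"
| "ends_high (x # r) \<longleftrightarrow> \<not> new_min x r"

text \<open>
  The argument is a reversed prefix of the input. In a permutation whose nonminima decrease, the only
  letters with a value between two nonminima that are adjacent in position are minima that precede
  both; the last condition thus excludes neighbours \<open>c, c - 1\<close> that are both nonminima, and does so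
  without reference to values that are still to come.
\<close>

fun admissible :: "nat list \<Rightarrow> bool" where
  "admissible [] \<longleftrightarrow> True"
| "admissible (x # r) \<longleftrightarrow> admissible r \<and>
     (new_min x r \<or>
      (\<forall>c\<in>set (nonminima r). x < c) \<and>
      (ends_high r \<longrightarrow> (\<exists>m\<in>set (minima r). x < m \<and> m < hd r)))"

text \<open>
  The stack after an admissible prefix: the newest letter always sits on top, and every older nonminimum
  has been popped.
\<close>

fun stack_after :: "nat list \<Rightarrow> nat list" where
  "stack_after [] = []"
| "stack_after (x # r) = x # minima r"

lemma set_minima_nonminima: "set r = set (minima r) \<union> set (nonminima r)"
  by (induction r) auto

lemma minima_in_set: "m \<in> set (minima r) \<Longrightarrow> m \<in> set r"
  using set_minima_nonminima by blast

lemma nonminima_in_set: "c \<in> set (nonminima r) \<Longrightarrow> c \<in> set r"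
  using set_minima_nonminima by blast

lemma sorted_minima: "sorted_wrt (<) (minima r)"
  by (induction r) (auto dest: minima_in_set)

lemma sorted_nonminima: "admissible r \<Longrightarrow> sorted_wrt (<) (nonminima r)"
  by (induction r) auto

lemma ex_minimum_le: "y \<in> set r \<Longrightarrow> \<exists>m\<in>set (minima r). m \<le> y"
proof (induction r arbitrary: y)
  case (Cons x r)
  show ?case
  proof (cases "y \<in> set r")
    case True
    then show ?thesis using Cons.IH by auto
  next
    case False
    then have "y = x" using Cons.prems by simp
    show ?thesis
    proof (cases "new_min x r")
      case False
      then obtain z where "z \<in> set r" "z \<le> x" by (meson not_less)
      then obtain m where "m \<in> set (minima r)" "m \<le> x" using Cons.IH order_trans by blast
      then show ?thesis unfolding minima.simps if_not_P[OF False] \<open>y = x\<close> by blast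
    qed (simp add: \<open>y = x\<close>)
  qed
qed simp

lemma minima_nonminima_disjoint:
  "distinct r \<Longrightarrow> set (minima r) \<inter> set (nonminima r) = {}"
  by (induction r) (auto dest: minima_in_set nonminima_in_set)

lemma ex_minimum_below:
  assumes "distinct r" "c \<in> set (nonminima r)"
  shows "\<exists>m\<in>set (minima r). m < c"
proof -
  have "c \<in> set r" using assms(2) nonminima_in_set by blast
  then obtain m where "m \<in> set (minima r)" "m \<le> c" using ex_minimum_le by blast
  then show ?thesis using minima_nonminima_disjoint[OF assms(1)] assms(2)
    by (metis disjoint_iff le_neq_implies_less)
qed

lemma stack_after_low: "\<not> ends_high r \<Longrightarrow> stack_after r = minima r"
  by (cases r) auto

lemma subseq_Cons_both: "subseq (a # w) (x # v) \<Longrightarrow> subseq w v"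
  by (cases "a = x") (auto dest: subseq_Cons')

lemma push_on_increasing:
  assumes "sorted_wrt (<) ms"
  shows "\<not> (\<exists>p\<in>T. contains_pattern (x # ms) p)"
proof -
  have no: "\<not> b < c" if "subseq [a, c, b] (x # ms)" for a b c
    using subseq_pair_sorted_wrt[OF assms subseq_Cons_both[OF that]] by simp
  then show ?thesis
    by (auto simp only: contains_132_iff contains_321_iff)
qed

text \<open>
  Only the single letter \<open>c\<close> above the increasing part can start a descent, so a forbidden pattern has
  to use \<open>x\<close>, \<open>c\<close> and some minimum \<open>m < c\<close>: it is 132 if \<open>x < m\<close> and 321 if \<open>c < x\<close>.
\<close>

lemma push_on_high_iff:
  assumes "sorted_wrt (<) ms"
  shows "(\<exists>p\<in>T. contains_pattern (x # c # ms) p) \<longleftrightarrow>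
         (\<exists>m\<in>set ms. m < c \<and> (x < m \<or> c < x))" (is "?L \<longleftrightarrow> ?R")
proof
  have descent: "u = x \<and> v = c \<and> w \<in> set ms"
    if occ: "subseq [u, v, w] (x # c # ms)" and "w < v" for u v w
  proof -
    have no: "\<not> subseq [v, w] ms"
      using subseq_pair_sorted_wrt[OF assms, of v w] \<open>w < v\<close> by auto
    have "subseq [v, w] (c # ms)" using subseq_Cons_both[OF occ] .
    then have "v = c \<and> w \<in> set ms" using no unfolding subseq_pair_Cons[of v w c] by blast
    moreover have "\<not> subseq [u, v, w] (c # ms)"
      using no subseq_Cons_both[of u "[v, w]" c ms] by blast
    then have "u = x" using subseq_Cons2_neq[OF occ] by blast
    ultimately show ?thesis by blast
  qed
  assume ?L
  then consider "contains_pattern (x # c # ms) [1, 3, 2]"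
    | "contains_pattern (x # c # ms) [3, 2, 1]" by blast
  then show ?R
  proof cases
    case 1
    then obtain u v w where "subseq [u, v, w] (x # c # ms)" "u < w" "w < v"
      unfolding contains_132_iff by blast
    then show ?R using descent[of u v w] by blast
  next
    case 2
    then obtain u v w where "subseq [u, v, w] (x # c # ms)" "w < v" "v < u"
      unfolding contains_321_iff by blast
    then show ?R using descent[of u v w] by blast
  qed
next
  assume ?R
  then obtain m where m: "m \<in> set ms" "m < c" "x < m \<or> c < x" by blast
  then have "subseq [x, c, m] (x # c # ms)" by (simp add: subseq_singleton_left)
  then have "contains_pattern (x # c # ms) [1, 3, 2] \<or> contains_pattern (x # c # ms) [3, 2, 1]"
    using m unfolding contains_132_iff contains_321_iff by blast
  then show ?L by blast
qed

lemma stack_run_increasing: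
  "sorted_wrt (<) ms \<Longrightarrow> stack_run T ms (x # ys) = stack_run T (x # ms) ys"
  using push_on_increasing[of ms x] by (cases ms) simp_all

lemma stack_run_pop:
  assumes "distinct r" "ends_high r" "\<exists>m\<in>set (minima r). m < hd r \<and> (x < m \<or> hd r < x)"
  shows "stack_run T (stack_after r) (x # ys) = hd r # stack_run T (x # minima r) ys"
proof -
  obtain c t where r: "r = c # t" using assms(2) by (cases r) auto
  then have min_r: "minima r = minima t" using assms(2) by auto
  then have "\<exists>p\<in>T. contains_pattern (x # c # minima t) p"
    using assms(3) push_on_high_iff[OF sorted_minima, of x c t] r by simp
  then have "stack_run T (c # minima t) (x # ys) = c # stack_run T (minima t) (x # ys)"
    by simp
  then show ?thesis
    using stack_run_increasing[OF sorted_minima] r min_r by simp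
qed

lemma nonminima_unfold_top:
  "nonminima r = (if ends_high r then hd r # nonminima (tl r) else nonminima (tl r))"
  by (cases r) auto

lemma ex_minimum_below_hd:
  assumes "distinct r" "ends_high r"
  shows "\<exists>m\<in>set (minima r). m < hd r"
proof -
  have "hd r \<in> set (nonminima r)" using assms(2) nonminima_unfold_top by simp
  then show ?thesis using ex_minimum_below assms(1) by blast
qed

text \<open>
  Each admissible letter pushes out a nonminimum that was on top: a new minimum does so through the
  pattern 132 with any minimum below the nonminimum, and a new nonminimum through the minimum
  between the two that admissibility provides.
\<close>

lemma stack_run_admissible:
  assumes "distinct r" "admissible r"
  shows "stack_run T [] (rev r @ ys) = rev (nonminima (tl r)) @ stack_run T (stack_after r) ys"
  using assms
proof (induction r arbitrary: ys)
  case (Cons x r)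
  have "stack_run T (stack_after r) (x # ys) =
      (if ends_high r then [hd r] else []) @ stack_run T (x # minima r) ys"
  proof (cases "ends_high r")
    case True
    obtain m where m: "m \<in> set (minima r)" "m < hd r"
      using ex_minimum_below_hd Cons.prems(1) True by auto
    have "\<exists>m\<in>set (minima r). m < hd r \<and> (x < m \<or> hd r < x)"
    proof (cases "new_min x r")
      case True
      then show ?thesis using m minima_in_set by blast
    next
      case False
      then show ?thesis using Cons.prems(2) \<open>ends_high r\<close> by auto
    qed
    then show ?thesis using stack_run_pop Cons.prems(1) True by simp
  next
    case False
    then show ?thesis
      using stack_after_low stack_run_increasing[OF sorted_minima] by simp
  qed
  then show ?case
    using Cons nonminima_unfold_top[of r] by simp
qed simp

text \<open>
  A letter \<open>x\<close> violates admissibility in one of two ways. If \<open>x\<close> lies above an earlier nonminimum \<open>c\<close>,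
  then \<open>c\<close> has left, or is forced out by 321, before \<open>x\<close> is pushed, and a minimum \<open>m < c\<close> leaves after
  \<open>x\<close>; this gives \<open>c x m\<close>. Otherwise no minimum separates \<open>x\<close> from a larger
  nonminimum \<open>c\<close> on top of the stack, and \<open>x\<close> is legally pushed onto it, so \<open>x c m\<close> is on the stack for some minimum \<open>m < x\<close>. Both are occurrences of 231.
\<close>

lemma stack_run_not_admissible:
  assumes "distinct (x # r)" "admissible r" "\<not> admissible (x # r)"
  shows "has_231 (stack_run T [] (rev r @ x # ys))"
proof -
  have dist: "distinct r" "x \<notin> set r" using assms(1) by auto
  have out: "stack_run T [] (rev r @ x # ys) =
      rev (nonminima (tl r)) @ stack_run T (stack_after r) (x # ys)"
    using stack_run_admissible assms by simp
  show ?thesis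
  proof (cases "\<exists>c\<in>set (nonminima r). c < x")
    case True
    then obtain c where c: "c \<in> set (nonminima r)" "c < x" by blast
    obtain m where m: "m \<in> set (minima r)" "m < c"
      using ex_minimum_below dist(1) c(1) by blast
    have "stack_run T [] (rev r @ x # ys) = rev (nonminima r) @ stack_run T (x # minima r) ys"
    proof (cases "ends_high r")
      case True
      obtain m' where m': "m' \<in> set (minima r)" "m' < hd r"
        using ex_minimum_below_hd dist(1) True by blast
      \<comment> \<open>The newest nonminimum is the smallest one, so it is also exceeded by \<open>x\<close> and must be popped.\<close>
      have "hd r \<le> c"
        using sorted_nonminima[OF assms(2)] c(1) nonminima_unfold_top[of r] True by auto
      then have "hd r < x" using c(2) by simp
      then show ?thesis
        using out stack_run_pop[OF dist(1) True] m' nonminima_unfold_top[of r] True by auto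
    next
      case False
      then show ?thesis
        using out stack_after_low stack_run_increasing[OF sorted_minima]
          nonminima_unfold_top[of r] by simp
    qed
    moreover have "subseq ([c] @ [x, m]) (rev (nonminima r) @ stack_run T (x # minima r) ys)"
    proof (rule list_emb_append_mono)
      show "subseq [c] (rev (nonminima r))" using c(1) by (simp add: subseq_singleton_left)
      have "subseq [x, m] (x # minima r)" using m(1) by (simp add: subseq_singleton_left)
      then show "subseq [x, m] (stack_run T (x # minima r) ys)"
        using subseq_stack_run subseq_order.order_trans by blast
    qed
    ultimately show ?thesis unfolding has_231_def using c(2) m(2) by auto
  next
    case False
    then have below: "\<forall>c\<in>set (nonminima r). x < c"
      using dist(2) nonminima_in_set by (metis linorder_neqE_nat)
    then have high: "ends_high r" and no: "\<not> (\<exists>m\<in>set (minima r). x < m \<and> m < hd r)"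
      and "\<not> new_min x r"
      using assms(2,3) by auto
    then obtain c t where r: "r = c # t" by (cases r) auto
    have min_r: "minima r = minima t" using high r by auto
    have "x < c" using below high nonminima_unfold_top[of r] r by simp
    then have "\<not> (\<exists>p\<in>T. contains_pattern (x # c # minima t) p)"
      using push_on_high_iff[OF sorted_minima, of x c t] no min_r r by auto
    then have run: "stack_run T (stack_after r) (x # ys) = stack_run T (x # c # minima t) ys"
      using r by simp
    obtain y where "y \<in> set r" "y < x"
      using \<open>\<not> new_min x r\<close> dist(2) by (metis linorder_neqE_nat)
    then obtain m where m: "m \<in> set (minima t)" "m < x"
      using ex_minimum_le min_r by (metis le_less_trans)
    then have "subseq [x, c, m] (x # c # minima t)" by (simp add: subseq_singleton_left)
    then have "has_231 (x # c # minima t)" unfolding has_231_def using m(2) \<open>x < c\<close> by blast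
    then show ?thesis unfolding out run
      by (meson has_231_subseq list_emb_append2 subseq_stack_run)
  qed
qed

lemma has_231_decreasing_increasing:
  assumes "sorted_wrt (>) u" "sorted_wrt (<) v"
  shows "\<not> has_231 (u @ v)"
proof
  assume "has_231 (u @ v)"
  then obtain a b c where "subseq [b, c, a] (u @ v)" "a < b" "b < c"
    unfolding has_231_def by blast
  then show False
  proof (cases rule: subseq_appendE)
    case (append p q)
    have "subseq [b, c] [b, c, a]" by simp
    then have "subseq [b, c, a] u \<Longrightarrow> subseq [b, c] u"
      using subseq_order.order_trans by blast
    with append have "subseq [b, c] u \<or> subseq [c, a] v"
      by (auto simp: Cons_eq_append_conv dest: subseq_Cons')
    then show False
      using subseq_pair_sorted_wrt[OF assms(1), of b c] subseq_pair_sorted_wrt[OF assms(2), of c a]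
        \<open>a < b\<close> \<open>b < c\<close> by auto
  qed
qed

lemma has_231_stack_map_iff:
  assumes "distinct r"
  shows "has_231 (stack_map T (rev r)) \<longleftrightarrow> \<not> admissible r"
proof (cases "admissible r")
  case True
  have "stack_map T (rev r) = rev (nonminima (tl r)) @ stack_after r"
    using stack_run_admissible[OF assms True, of "[]"] by (simp add: stack_map_def)
  also have "\<dots> = rev (nonminima r) @ minima r"
    by (cases r) auto
  finally show ?thesis
    using True has_231_decreasing_increasing sorted_nonminima[OF True] sorted_minima
    by (simp add: sorted_wrt_rev)
next
  case False
  then have "has_231 (stack_run T [] (rev r @ ys))" for ys
    using assms
  proof (induction r arbitrary: ys)
    case (Cons x r)
    then show ?case
      using stack_run_not_admissible[of x r ys] by (cases "admissible r") auto
  qed simp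
  from this[of "[]"] show ?thesis using False by (simp add: stack_map_def)
qed

lemma sortable_iff_admissible:
  assumes "rev r \<in> permutations_of_set {1..n}"
  shows "stack_sortable T (rev r) \<longleftrightarrow> admissible r"
proof -
  have "distinct r" using assms by (simp add: permutations_of_set_def)
  then show ?thesis using stack_sortable_iff[OF assms] has_231_stack_map_iff by simp
qed

section \<open>Building admissible permutations one letter at a time\<close>

definition bump :: "nat \<Rightarrow> nat \<Rightarrow> nat" where
  "bump q y = (if y < q then y else Suc y)"

abbreviation is_perm :: "nat \<Rightarrow> nat list \<Rightarrow> bool" where
  "is_perm n r \<equiv> distinct r \<and> set r = {1..n}"

lemma bump_less_iff [simp]: "bump q x < bump q y \<longleftrightarrow> x < y"
  by (auto simp: bump_def)

lemma less_bump_iff [simp]: "q < bump q y \<longleftrightarrow> q \<le> y"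
  by (auto simp: bump_def)

lemma inj_bump: "inj (bump q)"
  by (auto simp: inj_def bump_def split: if_splits)

lemma bump_neq [simp]: "bump q y \<noteq> q"
  by (auto simp: bump_def)

lemma minima_map_bump [simp]: "minima (map (bump q) r) = map (bump q) (minima r)"
  by (induction r) auto

lemma nonminima_map_bump [simp]: "nonminima (map (bump q) r) = map (bump q) (nonminima r)"
  by (induction r) auto

lemma ends_high_map_bump [simp]: "ends_high (map (bump q) r) \<longleftrightarrow> ends_high r"
  by (cases r) auto

lemma ends_high_nonempty: "ends_high r \<Longrightarrow> r \<noteq> []"
  by auto

lemma admissible_map_bump [simp]: "admissible (map (bump q) r) \<longleftrightarrow> admissible r"
proof (induction r)
  case (Cons x r)
  have "ends_high r \<Longrightarrow> hd (map (bump q) r) = bump q (hd r)"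
    by (simp add: ends_high_nonempty hd_map)
  then show ?case using Cons by auto
qed simp

lemma is_perm_Cons_bump_iff:
  assumes "1 \<le> q" "q \<le> Suc n"
  shows "is_perm (Suc n) (q # map (bump q) r) \<longleftrightarrow> is_perm n r"
proof -
  have "bump q ` {1..n} = {1..Suc n} - {q}"
  proof
    show "bump q ` {1..n} \<subseteq> {1..Suc n} - {q}"
      using assms by (auto simp: bump_def)
    show "{1..Suc n} - {q} \<subseteq> bump q ` {1..n}"
    proof
      fix y assume y: "y \<in> {1..Suc n} - {q}"
      show "y \<in> bump q ` {1..n}"
      proof (cases "y < q")
        case True
        then have "y = bump q y" "y \<in> {1..n}" using y assms by (auto simp: bump_def)
        then show ?thesis by blast
      next
        case False
        then have "y = bump q (y - 1)" "y - 1 \<in> {1..n}" using y assms by (auto simp: bump_def)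
        then show ?thesis by blast
      qed
    qed
  qed
  moreover have "set (q # map (bump q) r) = {1..Suc n} \<longleftrightarrow> bump q ` set r = {1..Suc n} - {q}"
    using assms by (auto simp: image_iff)
  ultimately have "set (q # map (bump q) r) = {1..Suc n} \<longleftrightarrow> set r = {1..n}"
    using inj_image_eq_iff[OF inj_bump] by metis
  moreover have "distinct (q # map (bump q) r) \<longleftrightarrow> distinct r"
    using inj_bump[of q] by (auto simp: distinct_map image_iff inj_on_subset[OF inj_bump])
      (metis bump_neq)
  ultimately show ?thesis by blast
qed

lemma ex_unbump:
  assumes "q \<notin> set t"
  shows "\<exists>r. t = map (bump q) r"
proof -
  have "t = map (bump q) (map (\<lambda>y. if y < q then y else y - 1) t)"
    using assms by (induction t) (auto simp: bump_def)
  then show ?thesis by blast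
qed

lemma new_min_bump_iff:
  assumes "is_perm n r" "1 \<le> q" "q \<le> Suc n"
  shows "new_min q (map (bump q) r) \<longleftrightarrow> q = 1"
proof
  assume *: "new_min q (map (bump q) r)"
  show "q = 1"
  proof (cases "n = 0")
    case False
    then have "1 \<in> set r" using assms(1) by simp
    then have "q \<le> 1" using * by auto
    then show ?thesis using assms(2) by simp
  qed (use assms in auto)
qed (use assms in auto)

text \<open>
  Without nonminima the value is one more than the largest letter, so that the bound it puts on a
  new nonminimum is void.
\<close>

definition lowest_nonminimum :: "nat \<Rightarrow> nat list \<Rightarrow> nat" where
  "lowest_nonminimum n r = (if nonminima r = [] then Suc n else hd (nonminima r))"

lemma lowest_nonminimum_Cons_bump:
  assumes "is_perm n r" "1 \<le> q" "q \<le> Suc n"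
    "q = 1 \<or> q \<le> lowest_nonminimum n r"
  shows "lowest_nonminimum (Suc n) (q # map (bump q) r) =
     (if q = 1 then Suc (lowest_nonminimum n r) else q)"
    and "ends_high (q # map (bump q) r) \<longleftrightarrow> q \<noteq> 1"
proof -
  have "bump 1 (hd (nonminima r)) = Suc (hd (nonminima r))" if "nonminima r \<noteq> []"
  proof -
    have "hd (nonminima r) \<in> set r" using that nonminima_in_set by simp
    then show ?thesis using assms(1) by (auto simp: bump_def)
  qed
  then show "lowest_nonminimum (Suc n) (q # map (bump q) r) =
     (if q = 1 then Suc (lowest_nonminimum n r) else q)"
    "ends_high (q # map (bump q) r) \<longleftrightarrow> q \<noteq> 1"
    using new_min_bump_iff[OF assms(1-3)] by (auto simp: lowest_nonminimum_def hd_map)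
qed

text \<open>
  If the previous letter is the lowest nonminimum \<open>c\<close> and \<open>q < c\<close>, then the letter \<open>q\<close> of the old
  permutation lies below all nonminima, hence is a minimum; after relabelling it is \<open>q + 1\<close> and
  separates \<open>q\<close> from \<open>c + 1\<close>. For \<open>q = c\<close> nothing lies between the two.
\<close>

lemma admissible_Cons_bump_iff:
  assumes "is_perm n r" "1 \<le> q" "q \<le> Suc n"
  shows "admissible (q # map (bump q) r) \<longleftrightarrow> admissible r \<and>
    (q = 1 \<or> q \<le> lowest_nonminimum n r \<and> \<not> (ends_high r \<and> q = lowest_nonminimum n r))"
proof (cases "admissible r")
  case adm: True
  note new_min = new_min_bump_iff[OF assms]
  have below: "(\<forall>c\<in>set (nonminima r). q \<le> c) \<longleftrightarrow> q \<le> lowest_nonminimum n r"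
    using sorted_nonminima[OF adm] assms(3)
    by (cases "nonminima r") (auto simp: lowest_nonminimum_def)
  have between: "(\<exists>m\<in>set (minima r). q \<le> m \<and> m < hd r) \<longleftrightarrow> q \<noteq> lowest_nonminimum n r"
    if high: "ends_high r" and le: "q \<le> lowest_nonminimum n r"
  proof -
    have hd: "lowest_nonminimum n r = hd r"
      using high nonminima_unfold_top[of r] by (simp add: lowest_nonminimum_def)
    show ?thesis
    proof
      assume "q \<noteq> lowest_nonminimum n r"
      then have "q < hd r" using le hd by simp
      moreover have "hd r \<in> set r" using high ends_high_nonempty by simp
      ultimately have "q \<in> set r" using assms by auto
      moreover have "q \<notin> set (nonminima r)"
        using below le high \<open>q < hd r\<close> sorted_nonminima[OF adm] nonminima_unfold_top[of r] by auto
      ultimately have "q \<in> set (minima r)" using set_minima_nonminima by blast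
      then show "\<exists>m\<in>set (minima r). q \<le> m \<and> m < hd r" using \<open>q < hd r\<close> by blast
    qed (use hd in auto)
  qed
  have "ends_high r \<Longrightarrow> hd (map (bump q) r) = bump q (hd r)"
    by (simp add: ends_high_nonempty hd_map)
  then have "admissible (q # map (bump q) r) \<longleftrightarrow> q = 1 \<or> (\<forall>c\<in>set (nonminima r). q \<le> c) \<and>
      (ends_high r \<longrightarrow> (\<exists>m\<in>set (minima r). q \<le> m \<and> m < hd r))"
    using adm new_min by auto
  then show ?thesis using adm below between by auto
qed simp

section \<open>Profiles\<close>

fun top_height :: "nat list \<Rightarrow> nat" where
  "top_height [] = 0"
| "top_height (h # hs) = h"

fun ends_rising :: "nat list \<Rightarrow> bool" where
  "ends_rising [] \<longleftrightarrow> False"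
| "ends_rising (h # hs) \<longleftrightarrow> top_height hs < h"

fun profile :: "nat list \<Rightarrow> bool" where
  "profile [] \<longleftrightarrow> True"
| "profile (h # hs) \<longleftrightarrow> profile hs \<and> top_height hs \<le> h \<and> h \<le> length hs \<and>
     \<not> (ends_rising hs \<and> h = Suc (top_height hs))"

text \<open>
  The new letter \<open>q\<close> is chosen so that the lowest nonminimum of the result, of length
  \<open>m = length hs + 1\<close>, is again \<open>m + 1\<close> minus the height: a repeated height stands for a new minimum,
  a larger height \<open>h\<close> for the nonminimum \<open>m + 1 - h\<close>.
\<close>

fun perm_of_profile :: "nat list \<Rightarrow> nat list" where
  "perm_of_profile [] = []"
| "perm_of_profile (h # hs) =
     (let q = (if h = top_height hs then 1 else length hs + 2 - h)
      in q # map (bump q) (perm_of_profile hs))"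

lemma top_height_le: "profile hs \<Longrightarrow> top_height hs \<le> length hs"
  by (cases hs) auto

lemma perm_of_profile_admissible:
  assumes "profile hs"
  shows "is_perm (length hs) (perm_of_profile hs) \<and> admissible (perm_of_profile hs) \<and>
    lowest_nonminimum (length hs) (perm_of_profile hs) = Suc (length hs) - top_height hs \<and>
    (ends_high (perm_of_profile hs) \<longleftrightarrow> ends_rising hs)"
  using assms
proof (induction hs)
  case Nil
  then show ?case by (simp add: lowest_nonminimum_def)
next
  case (Cons h hs)
  let ?n = "length hs" and ?r = "perm_of_profile hs"
  define q where "q = (if h = top_height hs then 1 else ?n + 2 - h)"
  have perm: "perm_of_profile (h # hs) = q # map (bump q) ?r" by (simp add: q_def Let_def)
  have IH: "is_perm ?n ?r" "admissible ?r" "lowest_nonminimum ?n ?r = Suc ?n - top_height hs"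
    "ends_high ?r \<longleftrightarrow> ends_rising hs"
    using Cons by auto
  have h: "top_height hs \<le> h" "h \<le> ?n" using Cons.prems by auto
  have q: "1 \<le> q" "q \<le> Suc ?n" "q = 1 \<longleftrightarrow> h = top_height hs"
    using h by (auto simp: q_def)
  have le: "q = 1 \<or> q \<le> lowest_nonminimum ?n ?r"
  proof (cases "h = top_height hs")
    case False
    then have "q = ?n + 2 - h" "Suc (top_height hs) \<le> h" using h(1) by (simp_all add: q_def)
    then show ?thesis unfolding IH(3) by linarith
  qed (simp add: q_def)
  have "\<not> (ends_high ?r \<and> q = lowest_nonminimum ?n ?r)" if "q \<noteq> 1"
  proof -
    have "q = ?n + 2 - h" "h \<noteq> top_height hs" using that q(3) by (auto simp: q_def)
    moreover have "ends_rising hs \<longrightarrow> h \<noteq> Suc (top_height hs)" using Cons.prems by simp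
    ultimately show ?thesis unfolding IH(3,4) using h by arith
  qed
  then have adm: "admissible (q # map (bump q) ?r)"
    unfolding admissible_Cons_bump_iff[OF IH(1) q(1,2)] using IH(2) le by blast
  have perm': "is_perm (Suc ?n) (q # map (bump q) ?r)"
    using is_perm_Cons_bump_iff[OF q(1,2)] IH(1) by blast
  have low: "lowest_nonminimum (Suc ?n) (q # map (bump q) ?r) = Suc (Suc ?n) - h"
    unfolding lowest_nonminimum_Cons_bump(1)[OF IH(1) q(1,2) le] IH(3) q(3)
    using h by (simp add: q_def Suc_diff_le)
  have "ends_high (q # map (bump q) ?r) \<longleftrightarrow> top_height hs < h"
    unfolding lowest_nonminimum_Cons_bump(2)[OF IH(1) q(1,2) le] q(3) using h by linarith
  with adm perm' low show ?case
    unfolding perm list.size(4) top_height.simps ends_rising.simps add_Suc_right add_0_right by blast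
qed

lemma perm_of_profile_inj:
  assumes "profile hs" "profile hs'" "length hs = length hs'"
    "perm_of_profile hs = perm_of_profile hs'"
  shows "hs = hs'"
  using assms
proof (induction hs arbitrary: hs')
  case (Cons h hs)
  then obtain k ks where hs': "hs' = k # ks" by (cases hs') auto
  have len: "length hs = length ks" using Cons.prems(3) hs' by simp
  define q where "q = (if h = top_height hs then 1 else length hs + 2 - h)"
  define p where "p = (if k = top_height ks then 1 else length ks + 2 - k)"
  have "q = p" "map (bump q) (perm_of_profile hs) = map (bump q) (perm_of_profile ks)"
    using Cons.prems(4) hs' by (auto simp: q_def p_def Let_def)
  then have "perm_of_profile hs = perm_of_profile ks"
    using inj_bump inj_map_eq_map by blast
  then have "hs = ks" using Cons hs' len by auto
  moreover have "h \<le> length hs" "k \<le> length ks" using Cons.prems hs' by auto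
  then have "h = k" using \<open>q = p\<close> \<open>hs = ks\<close> by (auto simp: q_def p_def split: if_splits)
  ultimately show ?case using hs' by simp
qed simp

text \<open>
  Removing the last letter and closing the gap that it leaves inverts one building step; the height
  to be added is read off from the removed letter.
\<close>

lemma ex_profile:
  assumes "is_perm n r" "admissible r"
  shows "\<exists>hs. profile hs \<and> length hs = n \<and> r = perm_of_profile hs"
  using assms
proof (induction n arbitrary: r)
  case 0
  then show ?case by (intro exI[of _ "[]"]) auto
next
  case (Suc n)
  then obtain q t where r: "r = q # t" by (cases r) auto
  then obtain r' where t: "t = map (bump q) r'" using Suc.prems ex_unbump[of q t] by auto
  have q: "1 \<le> q" "q \<le> Suc n" using Suc.prems(1) r by auto
  have r': "is_perm n r'" using is_perm_Cons_bump_iff[OF q] Suc.prems(1) r t by blast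
  have adm: "admissible r'" "q = 1 \<or> q \<le> lowest_nonminimum n r' \<and>
      \<not> (ends_high r' \<and> q = lowest_nonminimum n r')"
    using admissible_Cons_bump_iff[OF r' q] Suc.prems(2) r t by auto
  obtain hs where hs: "profile hs" "length hs = n" "r' = perm_of_profile hs"
    using Suc.IH r' adm(1) by blast
  note inv = perm_of_profile_admissible[OF hs(1), folded hs(3), unfolded hs(2)]
  have top: "top_height hs \<le> n" using top_height_le hs by blast
  define h where "h = (if q = 1 then top_height hs else n + 2 - q)"
  have "profile (h # hs)" using hs adm(2) inv top q by (auto simp: h_def)
  moreover have "perm_of_profile (h # hs) = r"
    using hs adm(2) inv top q r t by (auto simp: h_def Let_def)
  ultimately show ?case using hs(2) by (intro exI[of _ "h # hs"]) simp
qed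

lemma bij_betw_perm_of_profile:
  "bij_betw perm_of_profile {hs. profile hs \<and> length hs = n} {r. is_perm n r \<and> admissible r}"
  unfolding bij_betw_def
proof
  show "inj_on perm_of_profile {hs. profile hs \<and> length hs = n}"
  proof (rule inj_onI)
    fix hs hs'
    assume "hs \<in> {hs. profile hs \<and> length hs = n}" "hs' \<in> {hs. profile hs \<and> length hs = n}"
      "perm_of_profile hs = perm_of_profile hs'"
    then show "hs = hs'" using perm_of_profile_inj[of hs hs'] by simp
  qed
  show "perm_of_profile ` {hs. profile hs \<and> length hs = n} = {r. is_perm n r \<and> admissible r}"
  proof (intro equalityI subsetI)
    fix r assume "r \<in> perm_of_profile ` {hs. profile hs \<and> length hs = n}"
    then obtain hs where hs: "profile hs" "length hs = n" "r = perm_of_profile hs" by blast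
    then show "r \<in> {r. is_perm n r \<and> admissible r}"
      using perm_of_profile_admissible[OF hs(1)] by simp
  next
    fix r assume "r \<in> {r. is_perm n r \<and> admissible r}"
    then show "r \<in> perm_of_profile ` {hs. profile hs \<and> length hs = n}"
      using ex_profile[of r n] by blast
  qed
qed

lemma card_sortable:
  "card {xs \<in> permutations_of_set {1..n}. stack_sortable T xs} = card {hs. profile hs \<and> length hs = n}"
  (is "card ?S = card ?H")
proof -
  let ?A = "{r. is_perm n r \<and> admissible r}"
  have perm: "rev r \<in> permutations_of_set {1..n} \<longleftrightarrow> is_perm n r" for r
    unfolding permutations_of_set_def mem_Collect_eq set_rev distinct_rev by blast
  have mem: "rev r \<in> ?S \<longleftrightarrow> r \<in> ?A" for r
  proof (cases "is_perm n r")
    case True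
    then have "rev r \<in> permutations_of_set {1..n}" using perm by blast
    then show ?thesis
      unfolding mem_Collect_eq sortable_iff_admissible[OF \<open>rev r \<in> _\<close>] using True by blast
  qed (use perm in blast)
  have "?S = rev ` ?A"
  proof (intro equalityI subsetI)
    fix xs assume "xs \<in> ?S"
    then have "rev xs \<in> ?A" using mem[of "rev xs"] unfolding rev_rev_ident by blast
    then show "xs \<in> rev ` ?A" by (rule rev_image_eqI) (rule rev_rev_ident[symmetric])
  next
    fix xs assume "xs \<in> rev ` ?A"
    then show "xs \<in> ?S" using mem by blast
  qed
  then have "card ?S = card ?A" using card_image[OF inj_on_rev] by metis
  then show ?thesis using bij_betw_same_card[OF bij_betw_perm_of_profile, of n] by presburger
qed

section \<open>Dyck paths\<close>

definition ballot :: "step list \<Rightarrow> bool" where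
  "ballot w \<longleftrightarrow> (\<forall>v. prefix v w \<longrightarrow> count_list v D \<le> count_list v U)"

text \<open>
  The word ends with the up step of the newest height. The final run of down steps is left out,
  since it depends on the semilength only.
\<close>

fun word_of_profile :: "nat list \<Rightarrow> step list" where
  "word_of_profile [] = []"
| "word_of_profile (h # hs) = word_of_profile hs @ replicate (h - top_height hs) D @ [U]"

fun downs_before_ups :: "nat \<Rightarrow> step list \<Rightarrow> nat list" where
  "downs_before_ups d [] = []"
| "downs_before_ups d (U # w) = d # downs_before_ups d w"
| "downs_before_ups d (D # w) = downs_before_ups (Suc d) w"

fun weakly_rising :: "nat list \<Rightarrow> bool" where
  "weakly_rising [] \<longleftrightarrow> True"
| "weakly_rising (h # hs) \<longleftrightarrow> weakly_rising hs \<and> top_height hs \<le> h"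

lemma ballot_Nil [simp]: "ballot []"
  by (simp add: ballot_def)

lemma ballot_snoc [simp]:
  "ballot (w @ [U]) \<longleftrightarrow> ballot w"
  "ballot (w @ [D]) \<longleftrightarrow> ballot w \<and> count_list w D < count_list w U"
  by (auto simp: ballot_def)

lemma count_list_replicate [simp]: "count_list (replicate k x) y = (if x = y then k else 0)"
  by (induction k) auto

lemma ballot_append_D:
  "ballot (w @ replicate k D) \<longleftrightarrow> ballot w \<and> count_list w D + k \<le> count_list w U"
proof (induction k)
  case 0
  then show ?case by (auto simp: ballot_def)
next
  case (Suc k)
  have "w @ replicate (Suc k) D = (w @ replicate k D) @ [D]"
    by (simp add: replicate_append_same)
  then show ?case using Suc by (simp del: replicate_Suc append_assoc) auto
qed

lemma count_word_of_profile:
  assumes "weakly_rising hs"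
  shows "count_list (word_of_profile hs) U = length hs"
    and "count_list (word_of_profile hs) D = top_height hs"
  using assms by (induction hs) auto

text \<open>
  The pattern ends with an up step, so a final run of down steps contributes no occurrence.
\<close>

lemma sublist_DUDU_append_D:
  "sublist [D, U, D, U] (w @ replicate k D) \<longleftrightarrow> sublist [D, U, D, U] w"
proof (induction k)
  case (Suc k)
  have "w @ replicate (Suc k) D = (w @ replicate k D) @ [D]"
    by (simp add: replicate_append_same)
  then show ?case using Suc by (simp add: sublist_snoc del: replicate_Suc append_assoc)
qed simp

lemma not_suffix_D_word_of_profile: "\<not> suffix (zs @ [D]) (word_of_profile hs)"
proof (cases hs)
  case (Cons h hs')
  then have "word_of_profile hs = (word_of_profile hs' @ replicate (h - top_height hs') D) @ [U]"
    by simp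
  then show ?thesis by (simp del: append_assoc)
qed simp

lemma suffix_snoc_D:
  "suffix (zs @ [D]) (word_of_profile hs @ replicate k D) \<longleftrightarrow>
   0 < k \<and> suffix zs (word_of_profile hs @ replicate (k - 1) D)"
proof (cases k)
  case (Suc j)
  have "word_of_profile hs @ replicate k D = (word_of_profile hs @ replicate j D) @ [D]"
    by (simp add: Suc replicate_append_same)
  then show ?thesis by (simp add: Suc del: append_assoc replicate_Suc)
qed (simp add: not_suffix_D_word_of_profile)

lemma suffix_DU_word_of_profile:
  "suffix [D, U] (word_of_profile hs) \<longleftrightarrow> ends_rising hs"
proof (cases hs)
  case (Cons h hs')
  have "suffix ([D] @ [U]) ((word_of_profile hs' @ replicate (h - top_height hs') D) @ [U]) \<longleftrightarrow>
      ends_rising hs"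
    unfolding snoc_suffix_snoc using suffix_snoc_D[of "[]"] Cons by simp
  then show ?thesis using Cons by simp
qed simp

text \<open>
  The last two letters of the pattern say that the final run of down steps is nonempty. The up step
  before them makes its length exactly one, and then the first two letters are a valley at the end
  of the previous word.
\<close>

lemma suffix_DUDU_word_of_profile:
  "suffix [D, U, D, U] (word_of_profile (h # hs)) \<longleftrightarrow> ends_rising hs \<and> h = Suc (top_height hs)"
proof -
  let ?k = "h - top_height hs"
  have "suffix [D, U, D, U] (word_of_profile (h # hs)) \<longleftrightarrow>
      suffix ([D, U] @ [D]) (word_of_profile hs @ replicate ?k D)"
    using snoc_suffix_snoc[of "[D, U, D]" U "word_of_profile hs @ replicate ?k D" U] by simp
  also have "\<dots> \<longleftrightarrow> 0 < ?k \<and> suffix [D, U] (word_of_profile hs @ replicate (?k - 1) D)"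
    by (rule suffix_snoc_D)
  also have "\<dots> \<longleftrightarrow> ?k = 1 \<and> ends_rising hs"
  proof (cases "?k \<le> 1")
    case True
    then consider "?k = 0" | "?k = 1" by linarith
    then show ?thesis
    proof cases
      case 2
      show ?thesis unfolding 2 by (simp add: suffix_DU_word_of_profile)
    qed simp
  next
    case False
    define j where "j = ?k - 2"
    have j: "?k - 1 = Suc j" using False by (simp add: j_def)
    have "\<not> suffix ([D] @ [U]) ((word_of_profile hs @ replicate j D) @ [D])"
      unfolding snoc_suffix_snoc by simp
    then have "\<not> suffix [D, U] (word_of_profile hs @ replicate (?k - 1) D)"
      unfolding j by (simp add: replicate_append_same)
    then show ?thesis using False by simp
  qed
  also have "\<dots> \<longleftrightarrow> ends_rising hs \<and> h = Suc (top_height hs)" by auto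
  finally show ?thesis .
qed

lemma profile_iff_word:
  assumes "weakly_rising hs"
  shows "profile hs \<longleftrightarrow> ballot (word_of_profile hs) \<and> \<not> sublist [D, U, D, U] (word_of_profile hs)"
  using assms
proof (induction hs)
  case (Cons h hs)
  let ?v = "word_of_profile hs @ replicate (h - top_height hs) D"
  have h: "weakly_rising hs" "top_height hs \<le> h" using Cons.prems by auto
  have word: "word_of_profile (h # hs) = ?v @ [U]" by simp
  have "ballot (word_of_profile (h # hs)) \<longleftrightarrow> ballot (word_of_profile hs) \<and> h \<le> length hs"
    unfolding word ballot_snoc ballot_append_D count_word_of_profile[OF h(1)] using h(2) by simp
  moreover have "sublist [D, U, D, U] (word_of_profile (h # hs)) \<longleftrightarrow>
      ends_rising hs \<and> h = Suc (top_height hs) \<or> sublist [D, U, D, U] (word_of_profile hs)"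
    unfolding word sublist_snoc[of _ ?v] sublist_DUDU_append_D
    unfolding word[symmetric] suffix_DUDU_word_of_profile ..
  ultimately show ?case
    using Cons.IH[OF h(1)] h(2) unfolding profile.simps by blast
qed simp

lemma downs_before_ups_append:
  "downs_before_ups d (v @ w) = downs_before_ups d v @ downs_before_ups (d + count_list v D) w"
  by (induction d v rule: downs_before_ups.induct) auto

lemma downs_before_ups_replicate_D [simp]: "downs_before_ups d (replicate k D) = []"
  by (induction k arbitrary: d) auto

lemma downs_before_ups_word_of_profile:
  "weakly_rising hs \<Longrightarrow> downs_before_ups 0 (word_of_profile hs) = rev hs"
  by (induction hs) (auto simp: downs_before_ups_append count_word_of_profile)

text \<open>
  A word is recovered from the numbers of down steps before its up steps together with the total
  number of down steps, which fixes the final run.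
\<close>

lemma word_of_downs_before_ups:
  defines "hs w \<equiv> rev (downs_before_ups 0 w)"
  shows "weakly_rising (hs w) \<and> top_height (hs w) \<le> count_list w D \<and>
    word_of_profile (hs w) @ replicate (count_list w D - top_height (hs w)) D = w"
proof (induction w rule: rev_induct)
  case Nil
  then show ?case by (simp add: hs_def)
next
  case (snoc s w)
  show ?case
  proof (cases s)
    case U
    then have "hs (w @ [s]) = count_list w D # hs w"
      by (simp add: hs_def downs_before_ups_append)
    then show ?thesis using snoc U by simp
  next
    case D
    then have hs: "hs (w @ [s]) = hs w"
      by (simp add: hs_def downs_before_ups_append)
    have "replicate (Suc (count_list w D) - top_height (hs w)) D =
        replicate (count_list w D - top_height (hs w)) D @ [D]"
      using snoc by (simp add: Suc_diff_le replicate_append_same)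
    then show ?thesis using snoc D unfolding hs by simp
  qed
qed

lemma profile_weakly_rising: "profile hs \<Longrightarrow> weakly_rising hs"
  by (induction hs) auto

lemma card_dyck:
  "card {w. dyck_path n w \<and> \<not> sublist [D, U, D, U] w} = card {hs. profile hs \<and> length hs = n}"
  (is "card ?W = card ?H")
proof -
  let ?f = "\<lambda>hs. word_of_profile hs @ replicate (n - top_height hs) D"
  have iff: "?f hs \<in> ?W \<longleftrightarrow> hs \<in> ?H" if rising: "weakly_rising hs" and "top_height hs \<le> n" for hs
  proof -
    have "count_list (?f hs) U = length hs" "count_list (?f hs) D = n"
      using count_word_of_profile[OF rising] that(2) by simp_all
    moreover have "ballot (?f hs) \<longleftrightarrow> ballot (word_of_profile hs) \<and> n \<le> length hs"
      unfolding ballot_append_D count_word_of_profile[OF rising] using that(2) by simp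
    ultimately have "dyck_path n (?f hs) \<longleftrightarrow> ballot (word_of_profile hs) \<and> length hs = n"
      unfolding dyck_path_def ballot_def[symmetric] by (metis order_refl)
    then show ?thesis
      unfolding mem_Collect_eq sublist_DUDU_append_D profile_iff_word[OF rising] by blast
  qed
  have "downs_before_ups 0 (?f hs) = rev hs" if "profile hs" for hs
    using downs_before_ups_word_of_profile[OF profile_weakly_rising[OF that]]
    by (simp add: downs_before_ups_append)
  then have inj: "inj_on ?f ?H"
    by (intro inj_on_inverseI[where g = "\<lambda>w. rev (downs_before_ups 0 w)"]) simp
  have "?f ` ?H = ?W"
  proof (intro equalityI subsetI)
    fix w assume "w \<in> ?f ` ?H"
    then obtain hs where hs: "hs \<in> ?H" "w = ?f hs" by blast
    then have "weakly_rising hs" "top_height hs \<le> n"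
      using profile_weakly_rising top_height_le by blast+
    then show "w \<in> ?W" using iff hs by blast
  next
    fix w assume w: "w \<in> ?W"
    define hs where "hs = rev (downs_before_ups 0 w)"
    have "count_list w D = n" using w by (simp add: dyck_path_def)
    then have hs: "weakly_rising hs" "top_height hs \<le> n" "w = ?f hs"
      using word_of_downs_before_ups[of w] unfolding hs_def by simp_all
    then have "hs \<in> ?H" using iff[OF hs(1,2)] w unfolding hs(3)[symmetric] by blast
    then show "w \<in> ?f ` ?H" using hs(3) by blast
  qed
  then show ?thesis using card_image[OF inj] by metis
qed

theorem corollary6p13:
  fixes n :: nat
  assumes "n \<ge> 1"
  shows "card {xs \<in> permutations_of_set {1..n}. stack_sortable {[1, 3, 2], [3, 2, 1]} xs} =
         card {w. dyck_path n w \<and> \<not> sublist [D, U, D, U] w}"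
  by (rule trans[OF card_sortable card_dyck[symmetric]])

end
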